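(* Let $G$ be a finite group. Then, as $r\to\infty$, \[ |\mathrm{Hom}(\mathbb Z^r,G)|=N_{\max}(G)\,m(G)^r+O\bigl(b(G)^r\bigr). \] Equivalently, \[ P_r(G)=N_{\max}(G)\Bigl(\frac{m(G)}{|G|}\Bigr)^r+O\Bigl(\Bigl(\frac{b(G)}{|G|}\Bigr)^r\Bigr), \qquad \kappa_r(G)=\frac{N_{\max}(G)\,m(G)}{|G|}\,m(G)^r+O\bigl(b(G)^r\bigr). \] Hence \[ \lim_{r\to\infty}P_r(G)^{1/r}=\frac{m(G)}{|G|}, \qquad \lim_{r\to\infty}\kappa_r(G)^{1/r}=m(G). \]
   Context: For a finite group $G$ and an integer $r\ge 1$, $\mathrm{Hom}(\mathbb Z^r,G)$ is identified with the set of $r$-tuples $(x_1,\dots,x_r)\in G^r$ of pairwise commuting elements. $P_r(G):=|\mathrm{Hom}(\mathbb Z^r,G)|/|G|^r$, and $\kappa_r(G):=|\mathrm{Hom}(\mathbb Z^r,G)/G|$ is the number of orbits of $G$ acting on $\mathrm{Hom}(\mathbb Z^r,G)$ by diagonal (simultaneous) conjugation. $m(G)$ is the maximum order of an abelian subgroup of $G$; $N_{\max}(G)$ is the number of abelian subgroups of $G$ of order $m(G)$. If $G$ is non-abelian, $b(G)$ is the second-largest order of an abelian subgroup of $G$, i.e. the largest order of an abelian subgroup among those of order $<m(G)$; if $G$ is abelian, $b(G):=0$. The implied constants in $O(\cdot)$ may depend on $G$ but not on $r$. *)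

theory Defs
  imports Complex_Main "HOL-Algebra.Group_Action" "HOL-Library.Landau_Symbols"
begin

text \<open>\<open>Hom(Z^r, G)\<close>, identified with the set of \<open>r\<close>-tuples of pairwise commuting elements of \<open>G\<close>
  (the images of the standard basis of \<open>Z^r\<close>); a tuple is a list of length \<open>r\<close>.\<close>

definition Hom_Z :: "nat \<Rightarrow> ('a, 'b) monoid_scheme \<Rightarrow> 'a list set" where
  "Hom_Z r G = {xs. length xs = r \<and> set xs \<subseteq> carrier G \<and>
     (\<forall>i<r. \<forall>j<r. xs ! i \<otimes>\<^bsub>G\<^esub> xs ! j = xs ! j \<otimes>\<^bsub>G\<^esub> xs ! i)}"

text \<open>The restriction makes this an action in the sense of \<^locale>\<open>group_action\<close>, whose maps are
  required to be extensional on the set acted upon.\<close>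

definition diag_conj :: "nat \<Rightarrow> ('a, 'b) monoid_scheme \<Rightarrow> 'a \<Rightarrow> 'a list \<Rightarrow> 'a list" where
  "diag_conj r G g = (\<lambda>xs \<in> Hom_Z r G. map (\<lambda>x. g \<otimes>\<^bsub>G\<^esub> x \<otimes>\<^bsub>G\<^esub> inv\<^bsub>G\<^esub> g) xs)"

definition commuting_prob :: "nat \<Rightarrow> ('a, 'b) monoid_scheme \<Rightarrow> real" where
  "commuting_prob r G = real (card (Hom_Z r G)) / real (order G) ^ r"

definition kappa :: "nat \<Rightarrow> ('a, 'b) monoid_scheme \<Rightarrow> nat" where
  "kappa r G = card (orbits G (Hom_Z r G) (diag_conj r G))"

definition abelian_subgroups :: "('a, 'b) monoid_scheme \<Rightarrow> 'a set set" where
  "abelian_subgroups G = {H. subgroup H G \<and> comm_group (G\<lparr>carrier := H\<rparr>)}"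

definition max_abelian_order :: "('a, 'b) monoid_scheme \<Rightarrow> nat" where
  "max_abelian_order G = Max (card ` abelian_subgroups G)"

definition num_max_abelian :: "('a, 'b) monoid_scheme \<Rightarrow> nat" where
  "num_max_abelian G = card {H \<in> abelian_subgroups G. card H = max_abelian_order G}"

definition second_abelian_order :: "('a, 'b) monoid_scheme \<Rightarrow> nat" where
  "second_abelian_order G = (if comm_group G then 0
     else Max (card ` {H \<in> abelian_subgroups G. card H < max_abelian_order G}))"

end

theory Submission
  imports Defs "HOL-Algebra.Generated_Groups"
begin

text \<open>A commuting tuple generates an abelian subgroup, so \<open>Hom(Z^r, G)\<close> is the union of the sets
  \<open>H^r\<close> over the abelian subgroups \<open>H\<close>. The subgroups of order \<open>m(G)\<close> contribute
  \<open>N\<^sub>m\<^sub>a\<^sub>x(G) m(G)^r\<close>; the others, as well as the overlaps \<open>H^r \<inter> K^r = (H \<inter> K)^r\<close> of two different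
  maximal ones, only contribute \<open>O(b(G)^r)\<close>. An element \<open>g\<close> fixes a commuting
  tuple \<open>xs\<close> if and only if \<open>g # xs\<close> is a commuting tuple, so Burnside's lemma gives
  \<open>\<kappa>\<^sub>r(G) |G| = |Hom(Z^(r+1), G)|\<close>. The limits follow from
  \<open>m(G)^r \<le> |Hom(Z^r, G)| \<le> C m(G)^r\<close>.\<close>

section \<open>Commuting tuples and the abelian subgroups they generate\<close>

lemma Hom_Z_iff:
  "xs \<in> Hom_Z r G \<longleftrightarrow> length xs = r \<and> set xs \<subseteq> carrier G \<and>
     (\<forall>x\<in>set xs. \<forall>y\<in>set xs. x \<otimes>\<^bsub>G\<^esub> y = y \<otimes>\<^bsub>G\<^esub> x)"
  unfolding Hom_Z_def by (fastforce simp: in_set_conv_nth)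

text \<open>Stated for arbitrary subsets because \<open>generate_abelian\<close> needs it twice: for
  a generating set, then for the subgroup generated by it.\<close>

lemma (in group) subgroup_centralizer:
  assumes "S \<subseteq> carrier G"
  shows "subgroup {g \<in> carrier G. \<forall>s\<in>S. g \<otimes> s = s \<otimes> g} G"
proof (rule subgroupI)
  fix g assume "g \<in> {g \<in> carrier G. \<forall>s\<in>S. g \<otimes> s = s \<otimes> g}"
  then have g: "g \<in> carrier G" "\<forall>s\<in>S. g \<otimes> s = s \<otimes> g" by auto
  have "inv g \<otimes> s = s \<otimes> inv g" if "s \<in> S" for s
    using that g assms inv_solve_left inv_solve_right m_assoc
    by (smt (verit) inv_closed m_closed subsetD)
  then show "inv g \<in> {g \<in> carrier G. \<forall>s\<in>S. g \<otimes> s = s \<otimes> g}" using g by auto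
next
  fix g h assume "g \<in> {g \<in> carrier G. \<forall>s\<in>S. g \<otimes> s = s \<otimes> g}" "h \<in> {g \<in> carrier G. \<forall>s\<in>S. g \<otimes> s = s \<otimes> g}"
  then show "g \<otimes> h \<in> {g \<in> carrier G. \<forall>s\<in>S. g \<otimes> s = s \<otimes> g}"
    using assms by (auto simp: subset_iff) (metis m_assoc)
next
  have "\<one> \<in> {g \<in> carrier G. \<forall>s\<in>S. g \<otimes> s = s \<otimes> g}" using assms by auto
  then show "{g \<in> carrier G. \<forall>s\<in>S. g \<otimes> s = s \<otimes> g} \<noteq> {}" by blast
qed auto

lemma (in group) abelian_subgroups_iff:
  "H \<in> abelian_subgroups G \<longleftrightarrow> subgroup H G \<and> (\<forall>x\<in>H. \<forall>y\<in>H. x \<otimes> y = y \<otimes> x)"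
proof -
  have "comm_group (G\<lparr>carrier := H\<rparr>)" if "subgroup H G" "\<forall>x\<in>H. \<forall>y\<in>H. x \<otimes> y = y \<otimes> x"
    using group.group_comm_groupI[OF subgroup_imp_group[OF that(1)]] that(2) by simp
  moreover have "x \<otimes> y = y \<otimes> x" if "comm_group (G\<lparr>carrier := H\<rparr>)" "x \<in> H" "y \<in> H" for x y
    using comm_groupE(4)[OF that(1), of x y] that(2,3) by simp
  ultimately show ?thesis unfolding abelian_subgroups_def by blast
qed

text \<open>A double centralizer argument: \<open>S\<close> lies in its own centralizer, hence so
  does \<open>generate G S\<close>. Since commuting is symmetric, \<open>S\<close> then lies in the
  centralizer of \<open>generate G S\<close>, and so, once more, does \<open>generate G S\<close>
  itself.\<close>

lemma (in group) generate_abelian: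
  assumes S: "S \<subseteq> carrier G" and comm: "\<And>x y. x \<in> S \<Longrightarrow> y \<in> S \<Longrightarrow> x \<otimes> y = y \<otimes> x"
  shows "generate G S \<in> abelian_subgroups G"
proof -
  have gen: "generate G S \<subseteq> carrier G" using generate_incl[OF S] .
  have "generate G S \<subseteq> {g \<in> carrier G. \<forall>s\<in>S. g \<otimes> s = s \<otimes> g}"
    using S comm by (intro generate_subgroup_incl subgroup_centralizer) auto
  then have "S \<subseteq> {g \<in> carrier G. \<forall>s\<in>generate G S. g \<otimes> s = s \<otimes> g}" using S by auto
  then have "generate G S \<subseteq> {g \<in> carrier G. \<forall>s\<in>generate G S. g \<otimes> s = s \<otimes> g}"
    by (intro generate_subgroup_incl subgroup_centralizer gen)
  then show ?thesis
    unfolding abelian_subgroups_iff using generate_is_subgroup[OF S] by blast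
qed

lemma (in group) Hom_Z_eq_UN_abelian_subgroups:
  "Hom_Z r G = (\<Union>H\<in>abelian_subgroups G. {xs. set xs \<subseteq> H \<and> length xs = r})"
proof (intro equalityI subsetI)
  fix xs assume "xs \<in> Hom_Z r G"
  then have "generate G (set xs) \<in> abelian_subgroups G" "length xs = r"
    by (auto simp: Hom_Z_iff intro!: generate_abelian)
  then show "xs \<in> (\<Union>H\<in>abelian_subgroups G. {xs. set xs \<subseteq> H \<and> length xs = r})"
    by (auto intro: generate.incl)
next
  fix xs assume "xs \<in> (\<Union>H\<in>abelian_subgroups G. {xs. set xs \<subseteq> H \<and> length xs = r})"
  then obtain H where "H \<in> abelian_subgroups G" "set xs \<subseteq> H" "length xs = r" by auto
  then show "xs \<in> Hom_Z r G"
    by (auto simp: Hom_Z_iff abelian_subgroups_iff subset_iff dest: subgroup.mem_carrier)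
qed

lemma finite_Hom_Z: "finite (carrier G) \<Longrightarrow> finite (Hom_Z r G)"
  by (rule finite_subset[OF _ finite_lists_length_eq[of "carrier G" r]]) (auto simp: Hom_Z_iff)

section \<open>Diagonal conjugation and the orbit count by Burnside's lemma\<close>

lemma (in group) group_action_diag_conj: "group_action G (Hom_Z r G) (diag_conj r G)"
proof -
  \<comment> \<open>After \<open>m_assoc\<close> has moved all brackets to the right, the inner
    factors \<open>inv g\<close> and \<open>g\<close> of a product of conjugates meet only in this
    shape.\<close>
  have cancel: "inv g \<otimes> (g \<otimes> z) = z" if "g \<in> carrier G" "z \<in> carrier G" for g z
    using that m_assoc[of "inv g" g z] by simp
  have conj_mult: "(g \<otimes> x \<otimes> inv g) \<otimes> (g \<otimes> y \<otimes> inv g) = g \<otimes> (x \<otimes> y) \<otimes> inv g"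
    if "g \<in> carrier G" "x \<in> carrier G" "y \<in> carrier G" for g x y
    using that by (simp add: m_assoc cancel)
  have closed: "diag_conj r G g xs \<in> Hom_Z r G" if "g \<in> carrier G" "xs \<in> Hom_Z r G" for g xs
    using that by (auto simp: diag_conj_def Hom_Z_iff subset_iff conj_mult)
  have conj_conj: "g \<otimes> (h \<otimes> x \<otimes> inv h) \<otimes> inv g = (g \<otimes> h) \<otimes> x \<otimes> inv (g \<otimes> h)"
    if "g \<in> carrier G" "h \<in> carrier G" "x \<in> carrier G" for g h x
    using that by (simp add: m_assoc inv_mult_group)
  have comp: "diag_conj r G g (diag_conj r G h xs) = diag_conj r G (g \<otimes> h) xs"
    if "g \<in> carrier G" "h \<in> carrier G" "xs \<in> Hom_Z r G" for g h xs
    using that closed[OF that(2,3)] by (auto simp: diag_conj_def conj_conj Hom_Z_iff subset_iff)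
  have one: "diag_conj r G \<one> xs = xs" if "xs \<in> Hom_Z r G" for xs
    using that by (auto simp: diag_conj_def Hom_Z_iff subset_iff intro!: map_idI)
  have ext: "diag_conj r G g \<in> extensional (Hom_Z r G)" for g
    by (simp add: diag_conj_def)
  have Bij: "diag_conj r G g \<in> Bij (Hom_Z r G)" if g: "g \<in> carrier G" for g
  proof -
    \<comment> \<open>Conjugation by \<open>inv g\<close> is the two-sided inverse, by
      \<open>comp\<close> and \<open>one\<close>.\<close>
    have "bij_betw (diag_conj r G g) (Hom_Z r G) (Hom_Z r G)"
      by (rule bij_betw_byWitness[where f' = "diag_conj r G (inv g)"])
        (use g closed in \<open>auto simp: comp one\<close>)
    then show ?thesis using ext by (simp add: Bij_def)
  qed
  have "diag_conj r G (g \<otimes> h) = compose (Hom_Z r G) (diag_conj r G g) (diag_conj r G h)"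
    if "g \<in> carrier G" "h \<in> carrier G" for g h
    by (rule extensionalityI[where A = "Hom_Z r G"])
      (use that in \<open>simp_all add: compose_eq comp ext\<close>)
  then have "diag_conj r G \<in> hom G (BijGroup (Hom_Z r G))"
    using Bij by (auto simp: hom_def BijGroup_def)
  then show ?thesis
    by (simp add: group_action_def group_hom_def group_hom_axioms_def group_BijGroup is_group)
qed

lemma (in group) kappa_times_order:
  assumes fin: "finite (carrier G)"
  shows "kappa r G * order G = card (Hom_Z (Suc r) G)"
proof -
  interpret group_action G "Hom_Z r G" "diag_conj r G" by (rule group_action_diag_conj)
  let ?I = "invariants (Hom_Z r G) (diag_conj r G)"
  have conj_fixes: "g \<otimes> x \<otimes> inv g = x \<longleftrightarrow> g \<otimes> x = x \<otimes> g" if "g \<in> carrier G" "x \<in> carrier G" for g x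
    using that by (metis inv_solve_right m_closed)
  have fixes_iff: "xs \<in> ?I g \<longleftrightarrow> g # xs \<in> Hom_Z (Suc r) G" if "g \<in> carrier G" for g xs
  proof (cases "xs \<in> Hom_Z r G")
    case True
    then have carr: "set xs \<subseteq> carrier G" by (simp add: Hom_Z_iff)
    have "diag_conj r G g xs = xs \<longleftrightarrow> (\<forall>x\<in>set xs. g \<otimes> x \<otimes> inv g = x)"
      using True map_eq_conv[of "\<lambda>x. g \<otimes> x \<otimes> inv g" xs id] by (simp add: diag_conj_def)
    also have "\<dots> \<longleftrightarrow> (\<forall>x\<in>set xs. g \<otimes> x = x \<otimes> g)"
      using carr that conj_fixes by blast
    also have "\<dots> \<longleftrightarrow> g # xs \<in> Hom_Z (Suc r) G"
      using True that by (auto simp: Hom_Z_iff)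
    finally show ?thesis using True by (simp add: invariants_def)
  next
    \<comment> \<open>Both sides fail: fixed points lie in \<open>Hom_Z r G\<close> by definition,
      and the tail of a commuting tuple is again commuting.\<close>
    case False
    then show ?thesis by (auto simp: invariants_def Hom_Z_iff)
  qed
  \<comment> \<open>Splitting off the head identifies commuting tuples of length
    \<open>Suc r\<close> with pairs of a group element and a tuple fixed by it; these pairs are what
    Burnside's lemma sums over.\<close>
  have "Hom_Z (Suc r) G = (\<lambda>(g, xs). g # xs) ` (SIGMA g:carrier G. ?I g)"
  proof (intro equalityI subsetI)
    fix ys assume ys: "ys \<in> Hom_Z (Suc r) G"
    then obtain g xs where "ys = g # xs" "g \<in> carrier G" by (cases ys) (auto simp: Hom_Z_iff)
    then show "ys \<in> (\<lambda>(g, xs). g # xs) ` (SIGMA g:carrier G. ?I g)"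
      using ys fixes_iff by force
  qed (auto simp: fixes_iff)
  then have "card (Hom_Z (Suc r) G) = card (SIGMA g:carrier G. ?I g)"
    by (simp add: card_image inj_on_def)
  also have "\<dots> = (\<Sum>g\<in>carrier G. card (?I g))"
    using fin finite_Hom_Z[OF fin] by (intro card_SigmaI) (auto simp: invariants_def)
  also have "\<dots> = kappa r G * order G"
    using burnside[OF fin finite_Hom_Z[OF fin]] by (simp add: kappa_def)
  finally show ?thesis by simp
qed

section \<open>Bounds for the number of commuting tuples in a finite group\<close>

context group
begin

context
  assumes fin: "finite (carrier G)"
begin

lemma finite_abelian_subgroups: "finite (abelian_subgroups G)"
  by (rule finite_subset[of _ "Pow (carrier G)"])
    (use fin in \<open>auto simp: abelian_subgroups_iff dest: subgroup.mem_carrier\<close>)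

lemma abelian_subgroup_finite: "H \<in> abelian_subgroups G \<Longrightarrow> finite H"
  using fin by (auto simp: abelian_subgroups_iff dest: subgroup.subset intro: finite_subset)

lemma card_le_max_abelian_order:
  "H \<in> abelian_subgroups G \<Longrightarrow> card H \<le> max_abelian_order G"
  unfolding max_abelian_order_def using finite_abelian_subgroups by simp

text \<open>Ensures that the maximum defining \<open>max_abelian_order\<close> is over a nonempty
  set and is positive.\<close>

lemma trivial_abelian_subgroup: "{\<one>} \<in> abelian_subgroups G"
  by (simp add: abelian_subgroups_iff triv_subgroup)

lemma max_abelian_order_attained:
  obtains H where "H \<in> abelian_subgroups G" "card H = max_abelian_order G"
proof -
  have "max_abelian_order G \<in> card ` abelian_subgroups G"
    unfolding max_abelian_order_def
    using finite_abelian_subgroups trivial_abelian_subgroup by (intro Max_in) auto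
  then show thesis using that by auto
qed

lemma max_abelian_order_pos: "max_abelian_order G > 0"
  using card_le_max_abelian_order[OF trivial_abelian_subgroup] by simp

lemma inter_abelian_subgroup:
  "H \<in> abelian_subgroups G \<Longrightarrow> K \<in> abelian_subgroups G \<Longrightarrow> H \<inter> K \<in> abelian_subgroups G"
  by (auto simp: abelian_subgroups_iff subgroups_Inter_pair)

text \<open>The tuples inside a single abelian subgroup of maximal order already suffice.\<close>

lemma power_max_abelian_order_le_card_Hom_Z:
  "max_abelian_order G ^ r \<le> card (Hom_Z r G)"
proof -
  obtain H where H: "H \<in> abelian_subgroups G" "card H = max_abelian_order G"
    by (rule max_abelian_order_attained)
  have "card {xs. set xs \<subseteq> H \<and> length xs = r} \<le> card (Hom_Z r G)"
    using H by (intro card_mono finite_Hom_Z fin) (auto simp: Hom_Z_eq_UN_abelian_subgroups)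
  then show ?thesis using H by (simp add: card_lists_length_eq abelian_subgroup_finite)
qed

text \<open>The union bound, kept general in \<open>B\<close> and \<open>b\<close>: it serves for
  all abelian subgroups with the maximal order as bound, and for the non-maximal ones with the
  second-largest order.\<close>

lemma card_UN_lists_le:
  assumes "B \<subseteq> abelian_subgroups G" "\<And>H. H \<in> B \<Longrightarrow> card H \<le> b"
  shows "card (\<Union>H\<in>B. {xs. set xs \<subseteq> H \<and> length xs = r}) \<le> card B * b ^ r"
proof -
  have "finite B" using assms(1) finite_abelian_subgroups by (rule finite_subset)
  then have "card (\<Union>H\<in>B. {xs. set xs \<subseteq> H \<and> length xs = r})
      \<le> (\<Sum>H\<in>B. card {xs. set xs \<subseteq> H \<and> length xs = r})"
    by (rule card_UN_le)
  also have "\<dots> = (\<Sum>H\<in>B. card H ^ r)"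
    using assms(1) by (intro sum.cong card_lists_length_eq abelian_subgroup_finite) auto
  also have "\<dots> \<le> (\<Sum>H\<in>B. b ^ r)"
    using assms(2) by (intro sum_mono power_mono) auto
  finally show ?thesis by simp
qed

lemma card_Hom_Z_le: "card (Hom_Z r G) \<le> card (abelian_subgroups G) * max_abelian_order G ^ r"
  unfolding Hom_Z_eq_UN_abelian_subgroups
  by (rule card_UN_lists_le) (auto intro: card_le_max_abelian_order)

text \<open>Here \<open>second_abelian_order\<close> is 0, so the estimate leaves no room for an
  error once r > 0. The count is exact because \<open>carrier G\<close> is the only abelian subgroup
  of maximal order and contains every tuple.\<close>

lemma card_Hom_Z_abelian:
  assumes "comm_group G"
  shows "card (Hom_Z r G) = num_max_abelian G * max_abelian_order G ^ r"
proof -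
  interpret comm_group G by fact
  have carr: "carrier G \<in> abelian_subgroups G"
    by (simp add: abelian_subgroups_iff subgroup_self m_comm)
  have sub: "H \<subseteq> carrier G" if "H \<in> abelian_subgroups G" for H
    using that by (simp add: abelian_subgroups_iff subgroup.subset)
  have m: "max_abelian_order G = card (carrier G)"
    using card_le_max_abelian_order[OF carr] max_abelian_order_attained
      card_mono[OF fin sub] by (metis le_antisym)
  have "{H \<in> abelian_subgroups G. card H = max_abelian_order G} = {carrier G}"
    using carr card_subset_eq[OF fin sub] by (auto simp: m)
  then have "num_max_abelian G = 1" by (simp add: num_max_abelian_def)
  moreover have "Hom_Z r G = {xs. set xs \<subseteq> carrier G \<and> length xs = r}"
    using carr sub by (auto simp: Hom_Z_eq_UN_abelian_subgroups)
  ultimately show ?thesis by (simp add: m card_lists_length_eq fin)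
qed

text \<open>The constant works for every \<open>r\<close>, not just eventually, so the bound can
  also be used at \<open>Suc r\<close> for \<open>kappa\<close>.\<close>

lemma card_Hom_Z_estimate:
  obtains C where "\<And>r. \<bar>real (card (Hom_Z r G)) - real (num_max_abelian G) * real (max_abelian_order G) ^ r\<bar>
    \<le> C * real (second_abelian_order G) ^ r"
proof (cases "comm_group G")
  case True
  then have "\<bar>real (card (Hom_Z r G)) - real (num_max_abelian G) * real (max_abelian_order G) ^ r\<bar>
      \<le> 0 * real (second_abelian_order G) ^ r" for r
    by (simp add: card_Hom_Z_abelian)
  then show thesis by (rule that)
next
  case False
  define m where "m = max_abelian_order G"
  define b where "b = second_abelian_order G"
  define N where "N = num_max_abelian G"
  define M where "M = {H \<in> abelian_subgroups G. card H = m}"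
  define B where "B = {H \<in> abelian_subgroups G. card H < m}"
  have N: "N = card M" by (simp add: N_def num_max_abelian_def M_def m_def)
  have finM: "finite M" and finB: "finite B"
    using finite_abelian_subgroups by (simp_all add: M_def B_def)
  have B_le: "card H \<le> b" if "H \<in> B" for H
    using False finB that by (auto simp: b_def second_abelian_order_def B_def m_def intro!: Max_ge)
  \<comment> \<open>The upper bound costs \<open>card B * b ^ r\<close>, the lower bound
    \<open>N\<close> times as much; the constant is the sum of the two.\<close>
  have "\<bar>real (card (Hom_Z r G)) - real N * real m ^ r\<bar> \<le> real ((N + 1) * card B) * real b ^ r" for r
  proof -
    define L where "L H = {xs. set xs \<subseteq> H \<and> length xs = r}" for H :: "'a set"
    define U where "U = (\<Union>H\<in>B. L H)"
    have finL: "finite (L H)" and cardL: "card (L H) = card H ^ r"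
      if "H \<in> abelian_subgroups G" for H
      using abelian_subgroup_finite[OF that]
      by (simp_all add: L_def finite_lists_length_eq card_lists_length_eq)
    have sumM: "(\<Sum>H\<in>M. card (L H)) = N * m ^ r"
      unfolding N by (subst sum.cong[OF refl, of _ _ "\<lambda>_. m ^ r"]) (auto simp: M_def cardL)
    have finU: "finite U" using finB finL by (auto simp: U_def B_def)
    have cardU: "card U \<le> card B * b ^ r"
      unfolding U_def L_def by (rule card_UN_lists_le) (auto simp: B_le, auto simp: B_def)
    have "abelian_subgroups G = M \<union> B"
      using card_le_max_abelian_order by (fastforce simp: M_def B_def m_def)
    then have Hom: "Hom_Z r G = (\<Union>H\<in>M. L H) \<union> U"
      by (auto simp: Hom_Z_eq_UN_abelian_subgroups L_def U_def)
    have "card (Hom_Z r G) \<le> card (\<Union>H\<in>M. L H) + card U"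
      unfolding Hom by (rule card_Un_le)
    also have "\<dots> \<le> N * m ^ r + card B * b ^ r"
      using card_UN_le[OF finM, of L] sumM cardU by linarith
    finally have upper: "card (Hom_Z r G) \<le> N * m ^ r + card B * b ^ r" .
    \<comment> \<open>Two different subgroups of order \<open>m\<close> meet in an abelian subgroup
      of smaller order, so every tuple they share already belongs to \<open>U\<close>.\<close>
    have disj: "(L H - U) \<inter> (L K - U) = {}" if "H \<in> M" "K \<in> M" "H \<noteq> K" for H K
    proof -
      have HK: "H \<inter> K \<in> abelian_subgroups G" "finite H" "finite K" "card H = m" "card K = m"
        using that by (auto simp: M_def inter_abelian_subgroup abelian_subgroup_finite)
      then have "card (H \<inter> K) \<noteq> m"
        using that(3) by (metis card_subset_eq inf_le1 inf_le2)
      moreover have "card (H \<inter> K) \<le> m" using HK card_mono[of H "H \<inter> K"] by auto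
      ultimately have "H \<inter> K \<in> B" using HK by (simp add: B_def)
      then show ?thesis by (auto simp: U_def L_def)
    qed
    \<comment> \<open>Removing \<open>U\<close> costs each of the \<open>N\<close> sets
      \<open>L H\<close> at most \<open>card U\<close> tuples, and what remains is disjoint, so its
      sizes add up inside \<open>Hom_Z r G\<close>.\<close>
    have "N * m ^ r \<le> (\<Sum>H\<in>M. card (L H - U) + card U)"
      unfolding sumM[symmetric]
      by (intro sum_mono) (use diff_card_le_card_Diff[OF finU] in \<open>simp add: le_diff_conv\<close>)
    also have "\<dots> = (\<Sum>H\<in>M. card (L H - U)) + N * card U"
      by (simp add: sum.distrib N)
    also have "(\<Sum>H\<in>M. card (L H - U)) = card (\<Union>H\<in>M. L H - U)"
      by (rule card_UN_disjoint[symmetric]) (use finM finL disj in \<open>auto simp: M_def\<close>)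
    also have "\<dots> \<le> card (Hom_Z r G)"
      using Hom by (intro card_mono finite_Hom_Z fin) auto
    finally have "N * m ^ r \<le> card (Hom_Z r G) + N * (card B * b ^ r)"
      using mult_le_mono2[OF cardU, of N] by linarith
    then have lower: "real N * real m ^ r \<le> real (card (Hom_Z r G)) + real N * (real (card B) * real b ^ r)"
      by (metis of_nat_add of_nat_le_iff of_nat_mult of_nat_power)
    from upper have "real (card (Hom_Z r G)) \<le> real N * real m ^ r + real (card B) * real b ^ r"
      by (metis of_nat_add of_nat_le_iff of_nat_mult of_nat_power)
    moreover have "0 \<le> real (card B) * real b ^ r" "0 \<le> real N * (real (card B) * real b ^ r)" by auto
    moreover have "real ((N + 1) * card B) * real b ^ r
        = real N * (real (card B) * real b ^ r) + real (card B) * real b ^ r"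
      by (simp add: algebra_simps)
    ultimately show ?thesis using lower by linarith
  qed
  then show thesis unfolding N_def m_def b_def by (rule that)
qed

end

end

section \<open>Limits of r-th roots, and assembly of the asymptotics\<close>

lemma root_tendsto_geometric_rate:
  fixes f :: "nat \<Rightarrow> real"
  assumes "c > 0" "a > 0" and lower: "\<And>r. c * a ^ r \<le> f r" and upper: "\<And>r. f r \<le> C * a ^ r"
  shows "(\<lambda>r. f r powr (1 / real r)) \<longlonglongrightarrow> a"
proof -
  \<comment> \<open>Comparing the two bounds at exponent 0 gives \<open>c \<le> C\<close>, hence
    positivity of \<open>C\<close>.\<close>
  have "c * a ^ 0 \<le> C * a ^ 0" using lower upper order_trans by blast
  then have C: "C > 0" using assms(1) by simp
  have lim: "(\<lambda>r. d powr (1 / real r) * a) \<longlonglongrightarrow> a" if "d > 0" for d :: real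
  proof -
    have "(\<lambda>r. d powr (1 / real r) * a) \<longlonglongrightarrow> d powr 0 * a"
      using that by (intro tendsto_intros lim_1_over_n) auto
    then show ?thesis using that by simp
  qed
  have root: "(d * a ^ r) powr (1 / real r) = d powr (1 / real r) * a" if "d > 0" "r > 0" for d r
    using that assms(2) by (simp add: powr_mult powr_powr flip: powr_realpow)
  show ?thesis
  \<comment> \<open>Taking roots turns the bounds into \<open>a\<close> times the r-th roots of
    \<open>c\<close> and \<open>C\<close>, which tend to 1. The index 0 is excluded, since
    \<open>1 / real 0\<close> is 0 and \<open>root\<close> would fail there.\<close>
  proof (rule tendsto_sandwich[OF _ _ lim[OF assms(1)] lim[OF C]])
    show "\<forall>\<^sub>F r in sequentially. c powr (1 / real r) * a \<le> f r powr (1 / real r)"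
      using eventually_gt_at_top[of 0]
    proof eventually_elim
      case (elim r)
      have "(c * a ^ r) powr (1 / real r) \<le> f r powr (1 / real r)"
        using assms lower by (intro powr_mono2) auto
      then show ?case using root[OF assms(1) elim] by simp
    qed
    show "\<forall>\<^sub>F r in sequentially. f r powr (1 / real r) \<le> C powr (1 / real r) * a"
      using eventually_gt_at_top[of 0]
    proof eventually_elim
      case (elim r)
      have "0 \<le> f r" using lower[of r] assms(1,2) by (smt (verit) mult_pos_pos zero_less_power)
      then have "f r powr (1 / real r) \<le> (C * a ^ r) powr (1 / real r)"
        using upper by (intro powr_mono2) auto
      then show ?case using root[OF C elim] by simp
    qed
  qed
qed

theorem theoremA:
  fixes G :: "('a, 'b) monoid_scheme"
  assumes "group G" and "finite (carrier G)"
  shows "(\<lambda>r. real (card (Hom_Z r G)) - real (num_max_abelian G) * real (max_abelian_order G) ^ r)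
           \<in> O[at_top](\<lambda>r. real (second_abelian_order G) ^ r)
       \<and> (\<lambda>r. commuting_prob r G
             - real (num_max_abelian G) * (real (max_abelian_order G) / real (order G)) ^ r)
           \<in> O[at_top](\<lambda>r. (real (second_abelian_order G) / real (order G)) ^ r)
       \<and> (\<lambda>r. real (kappa r G)
             - real (num_max_abelian G) * real (max_abelian_order G) / real (order G)
               * real (max_abelian_order G) ^ r)
           \<in> O[at_top](\<lambda>r. real (second_abelian_order G) ^ r)
       \<and> (\<lambda>r. commuting_prob r G powr (1 / real r))
           \<longlonglongrightarrow> real (max_abelian_order G) / real (order G)
       \<and> (\<lambda>r. real (kappa r G) powr (1 / real r)) \<longlonglongrightarrow> real (max_abelian_order G)"
proof -
  interpret group G by fact
  note fin = assms(2)
  define m where "m = real (max_abelian_order G)"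
  define b where "b = real (second_abelian_order G)"
  define N where "N = real (num_max_abelian G)"
  define n where "n = real (order G)"
  define h where "h r = real (card (Hom_Z r G))" for r
  define D where "D = real (card (abelian_subgroups G))"
  have m: "m > 0" using max_abelian_order_pos[OF fin] by (simp add: m_def)
  have n: "n > 0" using fin order_gt_0_iff_finite by (simp add: n_def)
  obtain C where C: "\<And>r. \<bar>h r - N * m ^ r\<bar> \<le> C * b ^ r"
    using card_Hom_Z_estimate[OF fin] unfolding h_def N_def m_def b_def by blast
  have prob: "commuting_prob r G = h r / n ^ r" for r
    by (simp add: commuting_prob_def h_def n_def)
  \<comment> \<open>This shift from \<open>r\<close> to \<open>Suc r\<close> is the source of the
    extra factors \<open>m / n\<close> and \<open>b / n\<close> in the constants for
    \<open>kappa\<close> below.\<close>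
  have kappa: "real (kappa r G) = h (Suc r) / n" for r
    using kappa_times_order[OF fin, of r] n
    by (metis h_def n_def nonzero_eq_divide_eq of_nat_mult less_irrefl)
  have lower: "m ^ r \<le> h r" for r
    using power_max_abelian_order_le_card_Hom_Z[OF fin, of r]
    unfolding m_def h_def by (metis of_nat_le_iff of_nat_power)
  have upper: "h r \<le> D * m ^ r" for r
    using card_Hom_Z_le[OF fin, of r]
    unfolding m_def h_def D_def by (metis of_nat_le_iff of_nat_power of_nat_mult)
  have b: "b \<ge> 0" by (simp add: b_def)
  have "(\<lambda>r. h r - N * m ^ r) \<in> O(\<lambda>r. b ^ r)"
    using C b by (intro bigoI[where c = C]) auto
  moreover have "(\<lambda>r. commuting_prob r G - N * (m / n) ^ r) \<in> O(\<lambda>r. (b / n) ^ r)"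
  proof (intro bigoI[where c = C] always_eventually allI)
    fix r
    have "commuting_prob r G - N * (m / n) ^ r = (h r - N * m ^ r) / n ^ r"
      by (simp add: prob power_divide diff_divide_distrib)
    then have "norm (commuting_prob r G - N * (m / n) ^ r) = \<bar>h r - N * m ^ r\<bar> / n ^ r"
      using n by simp
    also have "\<dots> \<le> C * b ^ r / n ^ r" using C n by (intro divide_right_mono) auto
    finally show "norm (commuting_prob r G - N * (m / n) ^ r) \<le> C * norm ((b / n) ^ r)"
      using b n by (simp add: power_divide)
  qed
  moreover have "(\<lambda>r. real (kappa r G) - N * m / n * m ^ r) \<in> O(\<lambda>r. b ^ r)"
  proof (intro bigoI[where c = "C * b / n"] always_eventually allI)
    fix r
    have "real (kappa r G) - N * m / n * m ^ r = (h (Suc r) - N * m ^ Suc r) / n"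
      by (simp add: kappa diff_divide_distrib)
    then have "norm (real (kappa r G) - N * m / n * m ^ r) = \<bar>h (Suc r) - N * m ^ Suc r\<bar> / n"
      using n by simp
    also have "\<dots> \<le> C * b ^ Suc r / n" using C[of "Suc r"] n by (intro divide_right_mono) auto
    finally show "norm (real (kappa r G) - N * m / n * m ^ r) \<le> C * b / n * norm (b ^ r)"
      using b n by simp
  qed
  moreover have "(\<lambda>r. commuting_prob r G powr (1 / real r)) \<longlonglongrightarrow> m / n"
    by (rule root_tendsto_geometric_rate[where c = 1 and C = D])
      (use m n lower upper in \<open>auto simp: prob power_divide field_simps\<close>)
  moreover have "(\<lambda>r. real (kappa r G) powr (1 / real r)) \<longlonglongrightarrow> m"
  proof (rule root_tendsto_geometric_rate[where c = "m / n" and C = "D * m / n"])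
    fix r
    show "m / n * m ^ r \<le> real (kappa r G)" "real (kappa r G) \<le> D * m / n * m ^ r"
      using m n lower[of "Suc r"] upper[of "Suc r"] by (auto simp: kappa field_simps)
  qed (use m n in auto)
  ultimately show ?thesis unfolding h_def N_def m_def b_def n_def by blast
qed

end
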